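(* There exist an absolute constant $K>0$ and real numbers $c(N,D)$, defined for all integers $N\ge 2$ and $D\ge 1$, with $$\left|c(N,D)-\frac{(3D+1)\,2^{D}}{12}\,N^{D+2}\right|\le K\,D\,2^{D}N^{D+1},$$ such that for all integers $N\ge2$, $D\ge1$ and every real $J\neq 0$, the ferro- or antiferromagnetic Heisenberg model on the $D$-dimensional rectangular lattice, $N$ spins wide in each dimension, with open boundary conditions (so $N_{\mathrm{tot}}=N^D$ qubits) satisfies the operator inequality $$\Delta\vec{S}^2\;\le\; c(N,D)\,\frac{\Delta H}{4J}.$$ That is, the inequality holds with $c=\frac{(3D+1)2^{D}}{12}N^{D+2}+O(D2^{D}N^{D+1})$.
   Context: The lattice with open boundary conditions is the graph with vertex set $\{1,\dots,N\}^D$ in which two sites are joined by an edge iff their $\ell^1$ distance is $1$ (no wrap-around); let $\mathcal{E}$ be its edge set. Each vertex $i$ carries a qubit $\mathbb{C}^2$ with Pauli vector $\vec{\sigma}_i=(\sigma_i^{\mathrm{x}},\sigma_i^{\mathrm{y}},\sigma_i^{\mathrm{z}})$ (acting as the identity on the other qubits), and $\vec\sigma_i\cdot\vec\sigma_k=\sigma_i^{\mathrm{x}}\sigma_k^{\mathrm{x}}+\sigma_i^{\mathrm{y}}\sigma_k^{\mathrm{y}}+\sigma_i^{\mathrm{z}}\sigma_k^{\mathrm{z}}$. The Heisenberg Hamiltonian is $H=-J\sum_{(i,k)\in\mathcal{E}}\vec{\sigma}_i\cdot\vec{\sigma}_k$, where each edge is counted once. Put $E_*=-J|\mathcal{E}|$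 and $\Delta H=H-E_* I=-J\sum_{(i,k)\in\mathcal{E}}(\vec\sigma_i\cdot\vec\sigma_k-I)$. The total spin is $\vec{S}=\sum_i\vec{\sigma}_i/2$, so that $\vec{S}^2=\frac14\sum_i\sum_k\vec\sigma_i\cdot\vec\sigma_k$, and $\Delta\vec{S}^2=\frac{N_{\mathrm{tot}}}{2}\left(\frac{N_{\mathrm{tot}}}{2}+1\right)I-\vec{S}^2$ with $N_{\mathrm{tot}}=N^D$. For Hermitian operators $A,B$, $A\le B$ means that $B-A$ is positive semidefinite. *)

theory Defs
  imports "HOL-Analysis.Analysis"
begin

type_synonym site = "nat \<Rightarrow> nat"

definition sites :: "nat \<Rightarrow> nat \<Rightarrow> site set" where
  "sites N D = ({1..D} \<rightarrow>\<^sub>E {1..N})"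

definition l1_dist :: "nat \<Rightarrow> site \<Rightarrow> site \<Rightarrow> int" where
  "l1_dist D i k = (\<Sum>d\<in>{1..D}. \<bar>int (i d) - int (k d)\<bar>)"

text \<open>Two sites at distance 1 differ in exactly one coordinate, so exactly one of
  \<open>i \<le> k\<close>, \<open>k \<le> i\<close> holds in the pointwise order. Orienting every edge
  upwards lists each of them once; see \<open>edges_orientation\<close> below.\<close>

definition edges :: "nat \<Rightarrow> nat \<Rightarrow> (site \<times> site) set" where
  "edges N D = {(i, k). i \<in> sites N D \<and> k \<in> sites N D \<and> l1_dist D i k = 1 \<and> i \<le> k}"

lemma edges_orientation:
  assumes i: "i \<in> sites N D" and k: "k \<in> sites N D" and dist: "l1_dist D i k = 1"
  shows "((i, k) \<in> edges N D) \<noteq> ((k, i) \<in> edges N D)"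
proof -
  have sym: "l1_dist D k i = 1"
    using dist by (simp add: l1_dist_def abs_minus_commute)
  have "\<exists>d\<in>{1..D}. \<bar>int (i d) - int (k d)\<bar> \<noteq> 0"
    using dist unfolding l1_dist_def by (metis (no_types, lifting) sum.neutral zero_neq_one)
  then obtain d where d: "d \<in> {1..D}" "i d \<noteq> k d" by auto
  have "l1_dist D i k = \<bar>int (i d) - int (k d)\<bar>
      + (\<Sum>e\<in>{1..D} - {d}. \<bar>int (i e) - int (k e)\<bar>)"
    unfolding l1_dist_def using d(1) by (intro sum.remove) auto
  moreover have "\<bar>int (i d) - int (k d)\<bar> \<ge> 1" using d(2) by linarith
  moreover have nn: "(\<Sum>e\<in>{1..D} - {d}. \<bar>int (i e) - int (k e)\<bar>) \<ge> 0"
    by (intro sum_nonneg) auto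
  ultimately have "(\<Sum>e\<in>{1..D} - {d}. \<bar>int (i e) - int (k e)\<bar>) = 0"
    using dist by linarith
  then have eq: "i e = k e" if "e \<in> {1..D}" "e \<noteq> d" for e
    using that by (subst (asm) sum_nonneg_eq_0_iff) auto
  have out: "i e = k e" if "e \<notin> {1..D}" for e
    using i k that unfolding sites_def by (metis PiE_arb)
  have same: "i e = k e" if "e \<noteq> d" for e
    using eq out that by blast
  have "(i \<le> k) = (i d \<le> k d)" "(k \<le> i) = (k d \<le> i d)"
    unfolding le_fun_def using same by (metis order_refl)+
  then show ?thesis
    using i k dist sym d(2) by (auto simp: edges_def)
qed

text \<open>The Hilbert space of qubits on a finite vertex set \<open>V\<close> is the space of functions on
  the computational basis \<open>V \<rightarrow>\<^sub>E UNIV\<close>; at each site the basis of the qubit is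
  indexed by the type \<open>2\<close>, matching the indices of \<open>complex^2^2\<close>. Values of a
  state outside \<open>basis V\<close> carry no meaning: the operators below, for sites in \<open>V\<close>,
  do not use them to compute values on \<open>basis V\<close>, and the inner product ignores them.\<close>

type_synonym 'v state = "('v \<Rightarrow> 2) \<Rightarrow> complex"
type_synonym 'v operator = "'v state \<Rightarrow> 'v state"

definition basis :: "'v set \<Rightarrow> ('v \<Rightarrow> 2) set" where
  "basis V = (V \<rightarrow>\<^sub>E UNIV)"

definition braket :: "'v set \<Rightarrow> 'v state \<Rightarrow> 'v state \<Rightarrow> complex" where
  "braket V \<phi> \<psi> = (\<Sum>s\<in>basis V. cnj (\<phi> s) * \<psi> s)"

definition hermitian_op :: "'v set \<Rightarrow> 'v operator \<Rightarrow> bool" where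
  "hermitian_op V A \<longleftrightarrow> (\<forall>\<phi> \<psi>. braket V \<phi> (A \<psi>) = braket V (A \<phi>) \<psi>)"

definition psd_op :: "'v set \<Rightarrow> 'v operator \<Rightarrow> bool" where
  "psd_op V A \<longleftrightarrow> hermitian_op V A \<and> (\<forall>\<psi>. 0 \<le> Re (braket V \<psi> (A \<psi>)))"

definition loewner_le :: "'v set \<Rightarrow> 'v operator \<Rightarrow> 'v operator \<Rightarrow> bool" where
  "loewner_le V A B \<longleftrightarrow>
     hermitian_op V A \<and> hermitian_op V B \<and> psd_op V (\<lambda>\<psi> s. B \<psi> s - A \<psi> s)"

definition pauli :: "complex^2^2^3" where
  "pauli = vector [vector [vector [0, 1], vector [1, 0]],
                   vector [vector [0, - \<i>], vector [\<i>, 0]],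
                   vector [vector [1, 0], vector [0, - 1]]]"

text \<open>The one-qubit matrix \<open>M\<close> acting on the tensor factor \<open>i\<close>, and the identity
  on all other factors.\<close>

definition on_site :: "complex^2^2 \<Rightarrow> 'v \<Rightarrow> 'v operator" where
  "on_site M i \<psi> s = (\<Sum>t\<in>UNIV. M $ s i $ t * \<psi> (s(i := t)))"

definition sigma :: "3 \<Rightarrow> 'v \<Rightarrow> 'v operator" where
  "sigma a i = on_site (pauli $ a) i"

definition sigma_dot :: "'v \<Rightarrow> 'v \<Rightarrow> 'v operator" where
  "sigma_dot i k \<psi> s = (\<Sum>a\<in>UNIV. (sigma a i \<circ> sigma a k) \<psi> s)"

definition heisenberg :: "real \<Rightarrow> nat \<Rightarrow> nat \<Rightarrow> site operator" where
  "heisenberg J N D \<psi> s = - of_real J * (\<Sum>(i, k)\<in>edges N D. sigma_dot i k \<psi> s)"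

definition E_star :: "real \<Rightarrow> nat \<Rightarrow> nat \<Rightarrow> real" where
  "E_star J N D = - J * real (card (edges N D))"

definition Delta_H :: "real \<Rightarrow> nat \<Rightarrow> nat \<Rightarrow> site operator" where
  "Delta_H J N D \<psi> s = heisenberg J N D \<psi> s - of_real (E_star J N D) * \<psi> s"

definition total_spin :: "3 \<Rightarrow> 'v set \<Rightarrow> 'v operator" where
  "total_spin a V \<psi> s = (\<Sum>i\<in>V. sigma a i \<psi> s / 2)"

definition total_spin_sq :: "'v set \<Rightarrow> 'v operator" where
  "total_spin_sq V \<psi> s = (\<Sum>a\<in>UNIV. (total_spin a V \<circ> total_spin a V) \<psi> s)"

definition Delta_S_sq :: "nat \<Rightarrow> nat \<Rightarrow> site operator" where
  "Delta_S_sq N D \<psi> s =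
     (let n = real (N ^ D)
      in of_real (n / 2 * (n / 2 + 1)) * \<psi> s - total_spin_sq (sites N D) \<psi> s)"

end

theory Submission
  imports Defs
begin

text \<open>
  On qubits \<open>\<sigma>\<^sub>i \<cdot> \<sigma>\<^sub>k = 2 P\<^sub>i\<^sub>k - I\<close> with the exchange operator \<open>P\<^sub>i\<^sub>k\<close>, so both operators are
  combinations of \<open>I - P\<^sub>i\<^sub>k\<close>, whose quadratic form is \<open>d(i,k)\<^sup>2 / 2\<close> for \<open>d(i,k) = \<parallel>\<psi> - P\<^sub>i\<^sub>k \<psi>\<parallel>\<close>.
  Among three qubits two have equal basis values, and this makes \<open>d\<close> a pseudometric on the sites.
  Going from site to site one coordinate at a time and applying Cauchy--Schwarz along the way
  bounds the sum of \<open>d\<^sup>2\<close> over all ordered pairs by \<open>D N\<^sup>D\<^sup>-\<^sup>1 (\<Sum>\<^sub>a\<^sub>b \<bar>a - b\<bar>)\<close> times its sum over the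
  edges, where \<open>\<Sum>\<^sub>a\<^sub>b \<bar>a - b\<bar> = N (N\<^sup>2 - 1) / 3\<close>; this is below the leading term claimed for \<open>c\<close>.
\<close>

section \<open>Exchange operators\<close>

abbreviation transp :: "'v \<Rightarrow> 'v \<Rightarrow> 'v \<Rightarrow> 'v" where
  "transp \<equiv> Transposition.transpose"

text \<open>The pigeonhole step through which the two-valuedness of a qubit enters
  \<open>exchange_dist_triangle\<close>.\<close>

lemma neq_neq_imp_eq_2:
  fixes a b c :: 2
  shows "a \<noteq> b \<Longrightarrow> b \<noteq> c \<Longrightarrow> a = c"
  using exhaust_2 by metis

lemma finite_basis: "finite V \<Longrightarrow> finite (basis V)"
  by (simp add: basis_def finite_PiE)

lemma transpose_in_basis:
  assumes "s \<in> basis V" "i \<in> V" "k \<in> V"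
  shows "s \<circ> transp i k \<in> basis V"
  using assms by (auto simp: basis_def PiE_iff extensional_def Transposition.transpose_def)

lemma comp_transp_twice: "(s \<circ> transp i k) \<circ> transp i k = s"
  by (simp add: comp_assoc)

lemma sum_basis_transpose:
  assumes "i \<in> V" "k \<in> V"
  shows "(\<Sum>s\<in>basis V. g (s \<circ> transp i k)) = (\<Sum>s\<in>basis V. g s)"
  by (rule sum.reindex_bij_witness[where i = "\<lambda>s. s \<circ> transp i k" and j = "\<lambda>s. s \<circ> transp i k"])
    (use assms in \<open>auto simp: comp_transp_twice intro: transpose_in_basis\<close>)

lemma upd_upd_transpose:
  "s(i := s k, k := s i) = s \<circ> transp i k"
  by (auto simp: fun_eq_iff Transposition.transpose_def)

text \<open>For equal values at \<open>i\<close> and \<open>k\<close> the xx and yy terms cancel and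
  zz gives \<open>\<psi> s\<close>; for opposite values xx and yy each give the exchanged
  coefficient and zz gives \<open>- \<psi> s\<close>.\<close>

lemma sigma_dot_exchange:
  assumes "i \<noteq> k"
  shows "sigma_dot i k \<psi> s = 2 * \<psi> (s \<circ> transp i k) - \<psi> s"
proof -
  have tr: "s \<circ> transp i k = s(i := s k, k := s i)"
    by (simp add: upd_upd_transpose)
  have s: "s i = 1 \<or> s i = 2" "s k = 1 \<or> s k = 2" using exhaust_2 by blast+
  \<comment> \<open>Spelling out the values at \<open>i\<close> and \<open>k\<close> brings all
    terms to the same update form once the cases fix these values; \<open>fun_upd_triv\<close> would
    undo this.\<close>
  have "\<psi> s = \<psi> (s(i := s i, k := s k))" by simp
  then show ?thesis
    unfolding tr using assms s
    by (elim disjE)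
      (simp_all add: sigma_dot_def sigma_def on_site_def pauli_def sum_3 sum_2 del: fun_upd_triv)
qed

text \<open>Each of the three Pauli matrices squares to the identity. These are the diagonal terms
  of the squared total spin.\<close>

lemma sigma_dot_same: "sigma_dot i i \<psi> s = 3 * \<psi> s"
proof -
  have s: "s i = 1 \<or> s i = 2" using exhaust_2 by blast
  have "\<psi> s = \<psi> (s(i := s i))" by simp
  then show ?thesis
    using s by (elim disjE)
      (simp_all add: sigma_dot_def sigma_def on_site_def pauli_def sum_3 sum_2 del: fun_upd_triv)
qed

section \<open>Weighted sums of exchange terms and their quadratic forms\<close>

text \<open>Weights over all ordered pairs let one form cover both operators: a constant weight for
  \<open>Delta_S_sq\<close>, a weight supported on the edges for \<open>Delta_H\<close>.\<close>

definition exchange_sum :: "'v set \<Rightarrow> ('v \<Rightarrow> 'v \<Rightarrow> real) \<Rightarrow> 'v operator" where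
  "exchange_sum V w \<psi> s =
     (\<Sum>i\<in>V. \<Sum>k\<in>V. of_real (w i k) * (\<psi> s - \<psi> (s \<circ> transp i k)))"

definition exchange_dist :: "'v set \<Rightarrow> 'v state \<Rightarrow> 'v \<Rightarrow> 'v \<Rightarrow> real" where
  "exchange_dist V \<psi> i k = L2_set (\<lambda>s. cmod (\<psi> s - \<psi> (s \<circ> transp i k))) (basis V)"

lemma braket_exchange_sum_right:
  "braket V \<phi> (exchange_sum V w \<psi>) =
     (\<Sum>i\<in>V. \<Sum>k\<in>V. of_real (w i k) *
        ((\<Sum>s\<in>basis V. cnj (\<phi> s) * \<psi> s) - (\<Sum>s\<in>basis V. cnj (\<phi> s) * \<psi> (s \<circ> transp i k))))"
proof -
  have "braket V \<phi> (exchange_sum V w \<psi>) =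
     (\<Sum>s\<in>basis V. \<Sum>i\<in>V. \<Sum>k\<in>V. of_real (w i k) *
        (cnj (\<phi> s) * \<psi> s - cnj (\<phi> s) * \<psi> (s \<circ> transp i k)))"
    unfolding braket_def exchange_sum_def sum_distrib_left
    by (intro sum.cong refl) (simp add: algebra_simps)
  also have "\<dots> = (\<Sum>i\<in>V. \<Sum>k\<in>V. \<Sum>s\<in>basis V. of_real (w i k) *
        (cnj (\<phi> s) * \<psi> s - cnj (\<phi> s) * \<psi> (s \<circ> transp i k)))"
    by (subst sum.swap, rule sum.cong[OF refl], rule sum.swap)
  finally show ?thesis by (simp add: sum_distrib_left[symmetric] sum_subtractf)
qed

lemma cnj_braket: "cnj (braket V \<phi> \<psi>) = braket V \<psi> \<phi>"
  by (simp add: braket_def mult.commute)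

text \<open>The weights are real, and each exchange permutes the basis as its own inverse, hence is
  self-adjoint.\<close>

lemma hermitian_exchange_sum: "hermitian_op V (exchange_sum V w)"
  unfolding hermitian_op_def
proof (intro allI)
  fix \<phi> \<psi>
  have "(\<Sum>s\<in>basis V. cnj (\<phi> s) * \<psi> (s \<circ> transp i k)) =
      (\<Sum>s\<in>basis V. \<psi> s * cnj (\<phi> (s \<circ> transp i k)))" if "i \<in> V" "k \<in> V" for i k
    using sum_basis_transpose[OF that, of "\<lambda>s. \<psi> s * cnj (\<phi> (s \<circ> transp i k))"]
    by (simp add: comp_transp_twice mult.commute)
  then have "braket V \<phi> (exchange_sum V w \<psi>) = cnj (braket V \<psi> (exchange_sum V w \<phi>))"
    unfolding braket_exchange_sum_right by (simp add: mult.commute)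
  then show "braket V \<phi> (exchange_sum V w \<psi>) = braket V (exchange_sum V w \<phi>) \<psi>"
    by (simp add: cnj_braket)
qed

text \<open>An exchange \<open>P\<close> preserves the norm, so the squared norm of
  \<open>\<psi> - P \<psi>\<close> is twice the real part of the form of \<open>I - P\<close> at
  \<open>\<psi>\<close>; hence the division by 2.\<close>

lemma Re_braket_exchange_sum:
  "Re (braket V \<psi> (exchange_sum V w \<psi>)) =
     (\<Sum>i\<in>V. \<Sum>k\<in>V. w i k * (exchange_dist V \<psi> i k)\<^sup>2) / 2"
proof -
  have "(exchange_dist V \<psi> i k)\<^sup>2 = 2 * Re ((\<Sum>s\<in>basis V. cnj (\<psi> s) * \<psi> s)
      - (\<Sum>s\<in>basis V. cnj (\<psi> s) * \<psi> (s \<circ> transp i k)))" if "i \<in> V" "k \<in> V" for i k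
  proof -
    have "(exchange_dist V \<psi> i k)\<^sup>2 = (\<Sum>s\<in>basis V. (cmod (\<psi> s - \<psi> (s \<circ> transp i k)))\<^sup>2)"
      by (simp add: exchange_dist_def L2_set_def sum_nonneg)
    also have "\<dots> = (\<Sum>s\<in>basis V. (cmod (\<psi> s))\<^sup>2 + (cmod (\<psi> (s \<circ> transp i k)))\<^sup>2
        - 2 * Re (cnj (\<psi> s) * \<psi> (s \<circ> transp i k)))"
      by (intro sum.cong refl) (simp only: cmod_power2 minus_complex.sel complex_cnj
        times_complex.sel cnj.sel, simp add: power2_eq_square algebra_simps)
    also have "\<dots> = 2 * (\<Sum>s\<in>basis V. (cmod (\<psi> s))\<^sup>2)
        - 2 * (\<Sum>s\<in>basis V. Re (cnj (\<psi> s) * \<psi> (s \<circ> transp i k)))"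
      using sum_basis_transpose[OF that, of "\<lambda>s. (cmod (\<psi> s))\<^sup>2"]
      by (simp add: sum.distrib sum_subtractf sum_distrib_left)
    also have "(\<Sum>s\<in>basis V. (cmod (\<psi> s))\<^sup>2) = (\<Sum>s\<in>basis V. Re (cnj (\<psi> s) * \<psi> s))"
      by (intro sum.cong refl) (simp only: cmod_power2, simp add: power2_eq_square)
    finally show ?thesis by (simp only: Re_sum minus_complex.sel right_diff_distrib)
  qed
  then show ?thesis
    by (simp add: braket_exchange_sum_right sum_divide_distrib Re_sum right_diff_distrib
      diff_divide_distrib cong: sum.cong)
qed

section \<open>The exchange pseudometric on sites\<close>

lemma exchange_dist_nonneg: "0 \<le> exchange_dist V \<psi> i k"
  by (simp add: exchange_dist_def)

lemma exchange_dist_self: "exchange_dist V \<psi> i i = 0"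
  by (simp add: exchange_dist_def L2_set_def)

lemma exchange_dist_commute: "exchange_dist V \<psi> i k = exchange_dist V \<psi> k i"
  by (simp add: exchange_dist_def Transposition.transpose_commute)

lemma L2_set_le_reindex:
  assumes "finite B" "inj_on \<pi> A" "\<pi> ` A \<subseteq> B"
  shows "L2_set (\<lambda>s. g (\<pi> s)) A \<le> L2_set g B"
proof -
  have "(\<Sum>s\<in>A. (g (\<pi> s))\<^sup>2) = (\<Sum>s\<in>\<pi> ` A. (g s)\<^sup>2)"
    using assms(2) by (simp add: sum.reindex)
  also have "\<dots> \<le> (\<Sum>s\<in>B. (g s)\<^sup>2)"
    using assms by (intro sum_mono2) auto
  finally show ?thesis by (simp add: L2_set_def)
qed

text \<open>Conjugating the exchange of \<open>j, k\<close> by that of \<open>i, j\<close> would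
  only give 2 d(i,j) + d(j,k). The sharp bound comes from arguing per basis state with
  \<open>s i \<noteq> s k\<close>, where one exchange of each kind suffices, and then applying
  Minkowski's inequality.\<close>

lemma exchange_dist_triangle:
  assumes V: "finite V" "i \<in> V" "j \<in> V" "k \<in> V"
  shows "exchange_dist V \<psi> i k \<le> exchange_dist V \<psi> i j + exchange_dist V \<psi> j k"
proof (cases "i = j \<or> j = k \<or> i = k")
  case True
  then show ?thesis
    using exchange_dist_nonneg[of V \<psi>] by (auto simp: exchange_dist_self)
next
  case False
  then have ne: "i \<noteq> j" "j \<noteq> i" "j \<noteq> k" "k \<noteq> j" "i \<noteq> k" "k \<noteq> i" by auto
  \<comment> \<open>If \<open>s i = s j \<noteq> s k\<close>, the exchange of \<open>i, k\<close> is that of \<open>j, k\<close> followed by that of \<open>i, j\<close>;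
    if \<open>s i \<noteq> s j = s k\<close>, it is that of \<open>i, j\<close> followed by that of \<open>j, k\<close>. The maps \<open>\<pi>\<close> and \<open>\<rho>\<close>
    give the basis vectors to which the exchanges of \<open>i, j\<close> and of \<open>j, k\<close> are applied.\<close>
  define A where "A = {s \<in> basis V. s i \<noteq> s k}"
  define \<pi> where "\<pi> s = (if s i = s j then s \<circ> transp j k else s)" for s :: "'a \<Rightarrow> 2"
  define \<rho> where "\<rho> s = (if s i = s j then s else s \<circ> transp i j)" for s :: "'a \<Rightarrow> 2"
  let ?f = "\<lambda>i k s. cmod (\<psi> s - \<psi> (s \<circ> transp i k))"
  have finB: "finite (basis V)" using V by (simp add: finite_basis)
  have jk: "s j = s k" if "s \<in> A" "s i \<noteq> s j" for s
    using that neq_neq_imp_eq_2[of "s j" "s i" "s k"] by (auto simp: A_def)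
  have le: "?f i k s \<le> ?f i j (\<pi> s) + ?f j k (\<rho> s)" if "s \<in> A" for s
  proof (cases "s i = s j")
    case True
    then have "s \<circ> transp i k = (s \<circ> transp j k) \<circ> transp i j"
      using False by (auto simp: fun_eq_iff Transposition.transpose_def)
    moreover have "\<pi> s = s \<circ> transp j k" "\<rho> s = s" using True by (simp_all add: \<pi>_def \<rho>_def)
    ultimately show ?thesis
      using dist_triangle[of "\<psi> s" "\<psi> (s \<circ> transp i k)" "\<psi> (s \<circ> transp j k)"]
      by (simp only: dist_norm)
  next
    case c: False
    have "(s \<circ> transp i k) x = ((s \<circ> transp i j) \<circ> transp j k) x" for x
      using jk[OF that c] ne by (simp add: Transposition.transpose_def)
    then have "s \<circ> transp i k = (s \<circ> transp i j) \<circ> transp j k" by blast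
    moreover have "\<pi> s = s" "\<rho> s = s \<circ> transp i j" using c by (simp_all add: \<pi>_def \<rho>_def)
    ultimately show ?thesis
      using dist_triangle[of "\<psi> s" "\<psi> (s \<circ> transp i k)" "\<psi> (s \<circ> transp i j)"]
      by (simp only: dist_norm)
  qed
  have inj_tr: "s = t" if "s \<circ> transp a b = t \<circ> transp a b" for s t :: "'a \<Rightarrow> 2" and a b
    using that by (metis comp_transp_twice)
  have inj\<pi>: "inj_on \<pi> A"
  proof (rule inj_onI)
    fix s t assume st: "s \<in> A" "t \<in> A" "\<pi> s = \<pi> t"
    \<comment> \<open>The image reveals which branch of \<open>\<pi>\<close> produced it, so the two
      branches, each injective, cannot collide.\<close>
    have im: "(\<pi> u i = \<pi> u k) = (u i = u j)" if "u \<in> A" for u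
      using that False by (auto simp: \<pi>_def A_def Transposition.transpose_def)
    show "s = t"
    proof (cases "s i = s j")
      case True
      then have "t i = t j" using im[OF st(1)] im[OF st(2)] st(3) by simp
      then show ?thesis using st(3) True inj_tr[of s j k t] by (simp add: \<pi>_def)
    next
      case False
      then have "t i \<noteq> t j" using im[OF st(1)] im[OF st(2)] st(3) by simp
      then show ?thesis using st(3) False by (simp add: \<pi>_def)
    qed
  qed
  have inj\<rho>: "inj_on \<rho> A"
  proof (rule inj_onI)
    fix s t assume st: "s \<in> A" "t \<in> A" "\<rho> s = \<rho> t"
    have im: "(\<rho> u i = \<rho> u k) = (u i \<noteq> u j)" if "u \<in> A" for u
    proof (cases "u i = u j")
      case c: False
      have "(u \<circ> transp i j) i = (u \<circ> transp i j) k"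
        using jk[OF that c] ne by (simp only: o_apply transpose_apply_first
          transpose_apply_other not_False_eq_True)
      then show ?thesis using c by (simp add: \<rho>_def)
    qed (use that in \<open>auto simp: \<rho>_def A_def\<close>)
    show "s = t"
    proof (cases "s i = s j")
      case True
      then have "t i = t j" using im[OF st(1)] im[OF st(2)] st(3) by simp
      then show ?thesis using st(3) True by (simp add: \<rho>_def)
    next
      case False
      then have "t i \<noteq> t j" using im[OF st(1)] im[OF st(2)] st(3) by simp
      then show ?thesis using st(3) False inj_tr[of s i j t] by (simp add: \<rho>_def)
    qed
  qed
  \<comment> \<open>Basis states with equal values at \<open>i\<close> and \<open>k\<close> are
    fixed by the exchange and contribute 0.\<close>
  have "exchange_dist V \<psi> i k = L2_set (?f i k) A"
  proof -
    have "s \<circ> transp i k = s" if "s i = s k" for s :: "'a \<Rightarrow> 2"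
      using that by (auto simp: fun_eq_iff Transposition.transpose_def)
    then have "(\<Sum>s\<in>basis V. (?f i k s)\<^sup>2) = (\<Sum>s\<in>A. (?f i k s)\<^sup>2)"
      using finB by (intro sum.mono_neutral_right) (auto simp: A_def)
    then show ?thesis by (simp add: exchange_dist_def L2_set_def)
  qed
  also have "\<dots> \<le> L2_set (\<lambda>s. ?f i j (\<pi> s) + ?f j k (\<rho> s)) A"
    using le by (intro L2_set_mono) auto
  also have "\<dots> \<le> L2_set (\<lambda>s. ?f i j (\<pi> s)) A + L2_set (\<lambda>s. ?f j k (\<rho> s)) A"
    by (rule L2_set_triangle_ineq)
  also have "L2_set (\<lambda>s. ?f i j (\<pi> s)) A \<le> exchange_dist V \<psi> i j"
    unfolding exchange_dist_def
    by (rule L2_set_le_reindex[OF finB inj\<pi>])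
      (use V in \<open>auto simp: \<pi>_def A_def intro: transpose_in_basis\<close>)
  also have "L2_set (\<lambda>s. ?f j k (\<rho> s)) A \<le> exchange_dist V \<psi> j k"
    unfolding exchange_dist_def
    by (rule L2_set_le_reindex[OF finB inj\<rho>])
      (use V in \<open>auto simp: \<rho>_def A_def intro: transpose_in_basis\<close>)
  finally show ?thesis by simp
qed

section \<open>Path comparison on the lattice\<close>

text \<open>Enlarging the square by one adds a row and a column, each summing to 1 + ... + N, and a
  corner equal to 0.\<close>

lemma sum_abs_diff:
  "(\<Sum>a\<in>{1..N}. \<Sum>b\<in>{1..N}. \<bar>real a - real b\<bar>) = real N * ((real N)\<^sup>2 - 1) / 3"
proof (induction N)
  case (Suc N)
  have row: "(\<Sum>a\<in>{1..N}. \<bar>real a - real (Suc N)\<bar>) = real N * (real N + 1) / 2"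
  proof -
    have "(\<Sum>a\<in>{1..N}. \<bar>real a - real (Suc N)\<bar>) = (\<Sum>a\<in>{1..N}. real (Suc N) - real a)"
      by (intro sum.cong) auto
    also have "\<dots> = real N * (real N + 1) / 2"
      using double_gauss_sum_from_Suc_0[of N, where 'a = real]
      by (simp add: sum_subtractf algebra_simps)
    finally show ?thesis .
  qed
  have row': "(\<Sum>b\<in>{1..N}. \<bar>real (Suc N) - real b\<bar>) = real N * (real N + 1) / 2"
    using row by (simp only: abs_minus_commute)
  have "(\<Sum>a\<in>{1..Suc N}. \<Sum>b\<in>{1..Suc N}. \<bar>real a - real b\<bar>) =
      (\<Sum>a\<in>{1..N}. \<Sum>b\<in>{1..N}. \<bar>real a - real b\<bar>)
      + (\<Sum>a\<in>{1..N}. \<bar>real a - real (Suc N)\<bar>) + (\<Sum>b\<in>{1..N}. \<bar>real (Suc N) - real b\<bar>)"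
    by (simp only: sum.nat_ivl_Suc' sum.cl_ivl_Suc sum.distrib) (simp add: sum.distrib)
  then show ?case
    unfolding Suc.IH row row' by (simp add: power2_eq_square field_simps)
qed simp

lemma finite_sites: "finite (sites N D)"
  by (simp add: sites_def finite_PiE)

lemma finite_edges: "finite (edges N D)"
  by (rule finite_subset[of _ "sites N D \<times> sites N D"]) (auto simp: edges_def finite_sites)

section \<open>Lattice lines parallel to an axis\<close>

text \<open>Sites with coordinate \<open>q\<close> erased: each element \<open>z\<close> stands for
  one line in direction \<open>q\<close>, traversed by \<open>z(q := a)\<close>.\<close>

definition hyperplane :: "nat \<Rightarrow> nat \<Rightarrow> nat \<Rightarrow> site set" where
  "hyperplane N D q = ({1..D} - {q} \<rightarrow>\<^sub>E {1..N})"

lemma card_hyperplane: "q \<in> {1..D} \<Longrightarrow> card (hyperplane N D q) = N ^ (D - 1)"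
  by (simp add: hyperplane_def card_PiE)

lemma upd_hyperplane:
  "q \<in> {1..D} \<Longrightarrow> z \<in> hyperplane N D q \<Longrightarrow> a \<in> {1..N} \<Longrightarrow> z(q := a) \<in> sites N D"
  by (auto simp: hyperplane_def sites_def PiE_iff extensional_def)

lemma upd_sites: "q \<in> {1..D} \<Longrightarrow> x \<in> sites N D \<Longrightarrow> a \<in> {1..N} \<Longrightarrow> x(q := a) \<in> sites N D"
  by (auto simp: sites_def PiE_iff extensional_def)

lemma hyperplane_eqI:
  assumes "z \<in> hyperplane N D q" "z' \<in> hyperplane N D q" "z(q := a) = z'(q := b)"
  shows "z = z'"
proof
  fix e
  show "z e = z' e"
  proof (cases "e = q")
    case True
    then show ?thesis using assms(1,2) by (simp add: hyperplane_def PiE_iff extensional_def)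
  next
    case False
    then show ?thesis using fun_cong[OF assms(3), of e] by simp
  qed
qed

lemma sum_sites_hyperplane:
  assumes q: "q \<in> {1..D}"
  shows "(\<Sum>x\<in>sites N D. g x) = (\<Sum>a\<in>{1..N}. \<Sum>z\<in>hyperplane N D q. g (z(q := a)))"
proof -
  let ?f = "\<lambda>(a, z). z(q := a) :: site"
  have inj: "inj_on ?f ({1..N} \<times> hyperplane N D q)"
  proof (rule inj_onI, clarify)
    fix a b z z'
    assume "z \<in> hyperplane N D q" "z' \<in> hyperplane N D q" and eq: "z(q := a) = z'(q := b)"
    then have "z = z'" by (rule hyperplane_eqI)
    then show "a = b \<and> z = z'" using fun_cong[OF eq, of q] by simp
  qed
  have img: "?f ` ({1..N} \<times> hyperplane N D q) = sites N D"
  proof (intro equalityI subsetI)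
    fix x assume "x \<in> sites N D"
    \<comment> \<open>Erasing a coordinate means setting it to \<open>undefined\<close>, the value
      of an extensional function off its domain.\<close>
    then have "x q \<in> {1..N}" "x(q := undefined) \<in> hyperplane N D q"
      using q by (auto simp: sites_def hyperplane_def PiE_iff extensional_def)
    then show "x \<in> ?f ` ({1..N} \<times> hyperplane N D q)"
      by (intro image_eqI[of _ _ "(x q, x(q := undefined))"]) auto
  qed (use q upd_hyperplane in auto)
  have "(\<Sum>x\<in>sites N D. g x) = (\<Sum>p\<in>{1..N} \<times> hyperplane N D q. g (?f p))"
    unfolding img[symmetric] by (subst sum.reindex[OF inj]) simp
  then show ?thesis
    by (simp add: sum.cartesian_product case_prod_unfold)
qed

text \<open>The \<open>m\<close>-th stop on the path from \<open>x\<close> to \<open>y\<close> that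
  replaces one coordinate at a time.\<close>

definition splice_sites :: "nat \<Rightarrow> site \<Rightarrow> site \<Rightarrow> site" where
  "splice_sites m x y = (\<lambda>e. if e \<in> {1..m} then y e else x e)"

lemma splice_sites_in:
  "m \<le> D \<Longrightarrow> x \<in> sites N D \<Longrightarrow> y \<in> sites N D \<Longrightarrow> splice_sites m x y \<in> sites N D"
  by (auto simp: splice_sites_def sites_def PiE_iff extensional_def)

lemma splice_sites_0: "splice_sites 0 x y = x"
  by (simp add: splice_sites_def)

lemma splice_sites_full:
  "x \<in> sites N D \<Longrightarrow> y \<in> sites N D \<Longrightarrow> splice_sites D x y = y"
  by (rule ext) (auto simp: splice_sites_def sites_def PiE_iff extensional_def)

lemma splice_sites_Suc:
  "splice_sites (Suc m) x y = (splice_sites m x y)(Suc m := y (Suc m))"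
  by (auto simp: splice_sites_def fun_eq_iff)

text \<open>Swapping the first \<open>m\<close> coordinates of two sites is an involution on pairs
  of sites.\<close>

lemma sum_splice_sites:
  assumes "m \<le> D"
  shows "(\<Sum>x\<in>sites N D. \<Sum>y\<in>sites N D. F (splice_sites m x y) (splice_sites m y x)) =
    (\<Sum>x\<in>sites N D. \<Sum>y\<in>sites N D. F x y)"
proof -
  have inv: "splice_sites m (splice_sites m x y) (splice_sites m y x) = x" for x y
    by (auto simp: splice_sites_def fun_eq_iff)
  let ?h = "\<lambda>(x, y). (splice_sites m x y, splice_sites m y x)"
  have "(\<Sum>p\<in>sites N D \<times> sites N D. case ?h p of (x, y) \<Rightarrow> F x y) =
      (\<Sum>(x, y)\<in>sites N D \<times> sites N D. F x y)"
    by (rule sum.reindex_bij_witness[where i = ?h and j = ?h])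
      (auto simp: inv splice_sites_in assms)
  then show ?thesis
    by (simp add: sum.cartesian_product case_prod_unfold)
qed

section \<open>Path comparison for an abstract pseudometric on the sites\<close>

locale lattice_pseudometric =
  fixes N D :: nat and d :: "site \<Rightarrow> site \<Rightarrow> real"
  assumes nonneg: "0 \<le> d x y"
    and self: "d x x = 0"
    and commute: "d x y = d y x"
    and triangle: "x \<in> sites N D \<Longrightarrow> y \<in> sites N D \<Longrightarrow> z \<in> sites N D \<Longrightarrow> d x z \<le> d x y + d y z"
begin

lemma path_le:
  assumes "\<And>m. m \<le> n \<Longrightarrow> x m \<in> sites N D"
  shows "d (x 0) (x n) \<le> (\<Sum>m<n. d (x m) (x (Suc m)))"
  using assms
proof (induction n)
  case (Suc n)
  have "d (x 0) (x (Suc n)) \<le> d (x 0) (x n) + d (x n) (x (Suc n))"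
    using Suc.prems by (intro triangle) auto
  also have "d (x 0) (x n) \<le> (\<Sum>m<n. d (x m) (x (Suc m)))"
    using Suc.prems by (intro Suc.IH) auto
  finally show ?case by simp
qed (simp add: self)

text \<open>Cauchy-Schwarz over the \<open>n\<close> steps. It serves both for unit steps along a
  line and for the \<open>D\<close> coordinate changes.\<close>

lemma path_sq_le:
  assumes "\<And>m. m \<le> n \<Longrightarrow> x m \<in> sites N D"
  shows "(d (x 0) (x n))\<^sup>2 \<le> real n * (\<Sum>m<n. (d (x m) (x (Suc m)))\<^sup>2)"
proof -
  have "(d (x 0) (x n))\<^sup>2 \<le> (\<Sum>m<n. d (x m) (x (Suc m)))\<^sup>2"
    using path_le[OF assms] nonneg by (intro power_mono) auto
  also have "\<dots> \<le> (\<Sum>m<n. (d (x m) (x (Suc m)))\<^sup>2) * real (card {..<n})"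
    by (rule sum_squared_le_sum_of_squares)
  finally show ?thesis by (simp add: mult.commute)
qed

text \<open>The sum runs over the whole line through \<open>x\<close>, so it does not depend on
  \<open>x q\<close>.\<close>

definition line_energy :: "nat \<Rightarrow> site \<Rightarrow> real" where
  "line_energy q x = (\<Sum>j\<in>{1..<N}. (d (x(q := j)) (x(q := Suc j)))\<^sup>2)"

lemma line_energy_upd: "line_energy q (x(q := a)) = line_energy q x"
  by (simp add: line_energy_def)

text \<open>Cauchy-Schwarz over the unit steps between \<open>a\<close> and \<open>b\<close>; the
  segment is then enlarged to the full line.\<close>

lemma line_sq_le:
  assumes "q \<in> {1..D}" "x \<in> sites N D" "a \<in> {1..N}" "b \<in> {1..N}"
  shows "(d (x(q := a)) (x(q := b)))\<^sup>2 \<le> \<bar>real a - real b\<bar> * line_energy q x"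
  using assms(3,4)
proof (induction a b rule: linorder_wlog)
  case (le a b)
  have "(d (x(q := a)) (x(q := b)))\<^sup>2 \<le>
      real (b - a) * (\<Sum>m<b - a. (d (x(q := a + m)) (x(q := a + Suc m)))\<^sup>2)"
    using path_sq_le[of "b - a" "\<lambda>m. x(q := a + m)"] le assms(1,2) by (auto simp: upd_sites)
  also have "(\<Sum>m<b - a. (d (x(q := a + m)) (x(q := a + Suc m)))\<^sup>2) =
      (\<Sum>j\<in>{a..<b}. (d (x(q := j)) (x(q := Suc j)))\<^sup>2)"
    by (rule sum.reindex_bij_witness[where i = "\<lambda>j. j - a" and j = "\<lambda>m. a + m"]) auto
  also have "\<dots> \<le> line_energy q x"
    unfolding line_energy_def using le by (intro sum_mono2) auto
  finally show ?case using le by (simp add: of_nat_diff mult_left_mono)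
next
  case (sym a b)
  then show ?case by (simp add: commute abs_minus_commute)
qed

text \<open>Every unit step on a line is an upward edge, and direction, line and position can be
  recovered from it, so no edge is counted twice.\<close>

lemma sum_line_energy_le_edges:
  "(\<Sum>q\<in>{1..D}. \<Sum>z\<in>hyperplane N D q. line_energy q z) \<le> (\<Sum>(i, k)\<in>edges N D. (d i k)\<^sup>2)"
proof -
  define T where "T = (SIGMA q:{1..D}. hyperplane N D q \<times> {1..<N})"
  define e :: "nat \<times> site \<times> nat \<Rightarrow> site \<times> site"
    where "e = (\<lambda>(q, z, j). (z(q := j), z(q := Suc j)))"
  have fin: "finite (hyperplane N D q)" for q
    by (simp add: hyperplane_def finite_PiE)
  have "inj_on e T"
  proof (rule inj_onI)
    fix t t' assume t: "t \<in> T" "t' \<in> T" "e t = e t'"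
    obtain q z j where q: "t = (q, z, j)" by (cases t)
    obtain q' z' j' where q': "t' = (q', z', j')" by (cases t')
    have eq: "z(q := j) = z'(q' := j')" "z(q := Suc j) = z'(q' := Suc j')"
      using t(3) by (auto simp: e_def q q')
    have "q = q'"
    proof (rule ccontr)
      \<comment> \<open>Otherwise \<open>z' q\<close> would equal both \<open>j\<close> and
        \<open>Suc j\<close>.\<close>
      assume "q \<noteq> q'"
      then show False
        using fun_cong[OF eq(1), of q] fun_cong[OF eq(2), of q] by simp
    qed
    moreover have "j = j'" using fun_cong[OF eq(1), of q] \<open>q = q'\<close> by simp
    moreover have "z = z'"
      using t(1,2) eq(1) \<open>q = q'\<close> by (intro hyperplane_eqI[of z N D q z' j j']) (auto simp: T_def q q')
    ultimately show "t = t'" by (simp add: q q')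
  qed
  moreover have "e ` T \<subseteq> edges N D"
  proof clarify
    fix i k q z j assume t: "(q, z, j) \<in> T" and ik: "(i, k) = e (q, z, j)"
    have i: "i = z(q := j)" "k = z(q := Suc j)" using ik by (auto simp: e_def)
    have "l1_dist D i k = (\<Sum>p\<in>{1..D}. if p = q then 1 else 0)"
      unfolding l1_dist_def i by (intro sum.cong) auto
    also have "\<dots> = 1" using t by (simp add: T_def)
    finally show "(i, k) \<in> edges N D"
      using t by (auto simp: edges_def i le_fun_def T_def intro!: upd_hyperplane)
  qed
  ultimately have "(\<Sum>t\<in>T. case e t of (i, k) \<Rightarrow> (d i k)\<^sup>2) \<le> (\<Sum>(i, k)\<in>edges N D. (d i k)\<^sup>2)"
    using finite_edges[of N D] by (subst sum.reindex[symmetric, unfolded o_def]) (auto intro: sum_mono2)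
  also have "(\<Sum>t\<in>T. case e t of (i, k) \<Rightarrow> (d i k)\<^sup>2) =
      (\<Sum>q\<in>{1..D}. \<Sum>z\<in>hyperplane N D q. line_energy q z)"
    unfolding T_def line_energy_def
    by (simp add: sum.Sigma sum.cartesian_product fin e_def case_prod_unfold)
  finally show ?thesis .
qed

text \<open>The step changes only coordinate \<open>Suc m\<close>. The factor
  \<open>N ^ (D - 1)\<close> counts the other coordinates of \<open>y\<close>, and the next one is
  the sum of all distances on a line.\<close>

lemma sum_step_le:
  assumes "m < D"
  shows "(\<Sum>x\<in>sites N D. \<Sum>y\<in>sites N D. (d (splice_sites m x y) (splice_sites (Suc m) x y))\<^sup>2) \<le>
    real (N ^ (D - 1)) * (real N * ((real N)\<^sup>2 - 1) / 3) *
      (\<Sum>z\<in>hyperplane N D (Suc m). line_energy (Suc m) z)"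
proof -
  let ?q = "Suc m"
  let ?F = "\<lambda>x y. \<bar>real (x ?q) - real (y ?q)\<bar> * line_energy ?q x"
  have q: "?q \<in> {1..D}" using assms by simp
  have row: "(\<Sum>y\<in>sites N D. \<bar>real a - real (y ?q)\<bar>) =
      real (N ^ (D - 1)) * (\<Sum>b\<in>{1..N}. \<bar>real a - real b\<bar>)" for a
    by (subst sum_sites_hyperplane[OF q]) (simp add: card_hyperplane[OF q] sum_distrib_left)
  \<comment> \<open>Splicing the first \<open>m\<close> coordinates leaves coordinate
    \<open>Suc m\<close> alone, so \<open>y ?q\<close> can be read off
    \<open>splice_sites m y x\<close>. This is the form that \<open>sum_splice_sites\<close>
    needs.\<close>
  have "(d (splice_sites m x y) (splice_sites ?q x y))\<^sup>2 \<le> ?F (splice_sites m x y) (splice_sites m y x)"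
    if xy: "x \<in> sites N D" "y \<in> sites N D" for x y
  proof -
    let ?u = "splice_sites m x y"
    have u: "?u \<in> sites N D" using assms xy by (intro splice_sites_in) auto
    have "y ?q \<in> {1..N}" "?u ?q \<in> {1..N}" using xy u q by (auto simp: sites_def PiE_iff)
    then show ?thesis
      using line_sq_le[OF q u, of "?u ?q" "y ?q"]
      by (simp add: splice_sites_Suc) (simp add: splice_sites_def)
  qed
  then have "(\<Sum>x\<in>sites N D. \<Sum>y\<in>sites N D. (d (splice_sites m x y) (splice_sites ?q x y))\<^sup>2) \<le>
      (\<Sum>x\<in>sites N D. \<Sum>y\<in>sites N D. ?F (splice_sites m x y) (splice_sites m y x))"
    by (intro sum_mono)
  also have "\<dots> = (\<Sum>x\<in>sites N D. \<Sum>y\<in>sites N D. ?F x y)"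
    using assms by (intro sum_splice_sites) simp
  also have "\<dots> = (\<Sum>x\<in>sites N D. line_energy ?q x * (\<Sum>y\<in>sites N D. \<bar>real (x ?q) - real (y ?q)\<bar>))"
    by (simp add: sum_distrib_left mult.commute)
  also have "\<dots> = (\<Sum>x\<in>sites N D. line_energy ?q x *
      (real (N ^ (D - 1)) * (\<Sum>b\<in>{1..N}. \<bar>real (x ?q) - real b\<bar>)))"
    by (simp only: row)
  also have "\<dots> = (\<Sum>a\<in>{1..N}. \<Sum>z\<in>hyperplane N D ?q. line_energy ?q z *
      (real (N ^ (D - 1)) * (\<Sum>b\<in>{1..N}. \<bar>real a - real b\<bar>)))"
    by (subst sum_sites_hyperplane[OF q]) (simp add: line_energy_upd)
  also have "\<dots> = real (N ^ (D - 1)) * (\<Sum>a\<in>{1..N}. \<Sum>b\<in>{1..N}. \<bar>real a - real b\<bar>) *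
      (\<Sum>z\<in>hyperplane N D ?q. line_energy ?q z)"
    by (simp add: sum_distrib_right[symmetric] sum_distrib_left[symmetric] mult_ac)
  finally show ?thesis unfolding sum_abs_diff .
qed

text \<open>A Poincare inequality for the grid: Cauchy-Schwarz over the \<open>D\<close> coordinate
  changes gives the factor \<open>D\<close>, and \<open>sum_step_le\<close> the rest.\<close>

theorem sum_pairs_le_sum_edges:
  assumes D: "D \<ge> 1"
  shows "(\<Sum>x\<in>sites N D. \<Sum>y\<in>sites N D. (d x y)\<^sup>2) \<le>
    real D * real N ^ D * ((real N)\<^sup>2 - 1) / 3 * (\<Sum>(i, k)\<in>edges N D. (d i k)\<^sup>2)"
\<comment> \<open>For \<open>N = 0\<close> the grid is empty because \<open>D \<ge> 1\<close>;
  otherwise \<open>N\<^sup>2 - 1\<close> is nonnegative, which makes multiplying by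
  \<open>?C\<close> monotone.\<close>
proof (cases "N = 0")
  case True
  then have "sites N D = {}" using D by (auto simp: sites_def PiE_eq_empty_iff)
  then show ?thesis by (simp add: edges_def)
next
  case False
  let ?s = "\<lambda>m x y. (d (splice_sites m x y) (splice_sites (Suc m) x y))\<^sup>2"
  let ?C = "real (N ^ (D - 1)) * (real N * ((real N)\<^sup>2 - 1) / 3)"
  have "(d x y)\<^sup>2 \<le> real D * (\<Sum>m<D. ?s m x y)" if "x \<in> sites N D" "y \<in> sites N D" for x y
    using path_sq_le[of D "\<lambda>m. splice_sites m x y"] that
    by (simp add: splice_sites_0 splice_sites_full splice_sites_in)
  then have "(\<Sum>x\<in>sites N D. \<Sum>y\<in>sites N D. (d x y)\<^sup>2) \<le>
      (\<Sum>x\<in>sites N D. \<Sum>y\<in>sites N D. real D * (\<Sum>m<D. ?s m x y))"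
    by (intro sum_mono)
  also have "\<dots> = real D * (\<Sum>x\<in>sites N D. \<Sum>y\<in>sites N D. \<Sum>m<D. ?s m x y)"
    by (simp add: sum_distrib_left)
  also have "(\<Sum>x\<in>sites N D. \<Sum>y\<in>sites N D. \<Sum>m<D. ?s m x y) =
      (\<Sum>m<D. \<Sum>x\<in>sites N D. \<Sum>y\<in>sites N D. ?s m x y)"
    by (simp only: sum.swap[where A = "sites N D" and B = "{..<D}"])
  also have "\<dots> \<le> (\<Sum>m<D. ?C * (\<Sum>z\<in>hyperplane N D (Suc m). line_energy (Suc m) z))"
    by (intro sum_mono sum_step_le) simp
  also have "\<dots> = ?C * (\<Sum>q\<in>{1..D}. \<Sum>z\<in>hyperplane N D q. line_energy q z)"
    unfolding sum_distrib_left[symmetric]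
    by (rule arg_cong[where f = "(*) ?C"],
        rule sum.reindex_bij_witness[where i = "\<lambda>q. q - 1" and j = Suc]) auto
  also have "\<dots> \<le> ?C * (\<Sum>(i, k)\<in>edges N D. (d i k)\<^sup>2)"
    using False by (intro mult_left_mono sum_line_energy_le_edges) simp_all
  finally have "(\<Sum>x\<in>sites N D. \<Sum>y\<in>sites N D. (d x y)\<^sup>2) \<le>
      real D * (?C * (\<Sum>(i, k)\<in>edges N D. (d i k)\<^sup>2))"
    by (simp add: mult_left_mono)
  moreover have "real N ^ D = real (N ^ (D - 1)) * real N"
    using D by (cases D) simp_all
  ultimately show ?thesis by (simp add: mult_ac)
qed

end

section \<open>The operator inequality\<close>

lemma edges_in_sites: "(i, k) \<in> edges N D \<Longrightarrow> i \<in> sites N D \<and> k \<in> sites N D \<and> i \<noteq> k"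
  by (auto simp: edges_def l1_dist_def)

text \<open>Brings edge sums into the weighted form of \<open>exchange_sum\<close>.\<close>

lemma sum_edges_eq:
  "(\<Sum>(i, k)\<in>edges N D. g i k) =
     (\<Sum>i\<in>sites N D. \<Sum>k\<in>sites N D. if (i, k) \<in> edges N D then g i k else 0)"
proof -
  have "(\<Sum>(i, k)\<in>edges N D. g i k) =
      (\<Sum>p\<in>sites N D \<times> sites N D. if p \<in> edges N D then g (fst p) (snd p) else 0)"
    unfolding case_prod_unfold
    by (rule sum.mono_neutral_cong_left) (use edges_in_sites in \<open>auto simp: finite_sites\<close>)
  then show ?thesis by (simp add: sum.cartesian_product case_prod_unfold)
qed

text \<open>With n sites, the identity parts of the squared spin add up to n^2/4 + n/2, exactly the
  maximal value, so only the exchange terms remain.\<close>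

lemma Delta_S_sq_exchange: "Delta_S_sq N D = exchange_sum (sites N D) (\<lambda>_ _. 1 / 2)"
proof (intro ext)
  fix \<psi> s
  let ?V = "sites N D"
  have card: "card ?V = N ^ D" by (simp add: sites_def card_PiE)
  have lin: "sigma a i (\<lambda>s. \<Sum>k\<in>?V. \<phi> k s / 2) t = (\<Sum>k\<in>?V. sigma a i (\<phi> k) t / 2)"
    for a i t and \<phi> :: "site \<Rightarrow> site state"
    unfolding sigma_def on_site_def
    by (simp add: sum_2 sum_divide_distrib sum_distrib_left sum.distrib add_divide_distrib)
  have "total_spin_sq ?V \<psi> s = (\<Sum>i\<in>?V. \<Sum>k\<in>?V. sigma_dot i k \<psi> s / 4)"
  proof -
    have "total_spin_sq ?V \<psi> s =
        (\<Sum>a\<in>UNIV. \<Sum>i\<in>?V. \<Sum>k\<in>?V. sigma a i (sigma a k \<psi>) s / 4)"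
      unfolding total_spin_sq_def total_spin_def comp_def
      by (simp add: lin sum_divide_distrib)
    also have "\<dots> = (\<Sum>i\<in>?V. \<Sum>k\<in>?V. \<Sum>a\<in>UNIV. sigma a i (sigma a k \<psi>) s / 4)"
      by (subst sum.swap, rule sum.cong[OF refl], rule sum.swap)
    finally show ?thesis by (simp add: sigma_dot_def sum_divide_distrib)
  qed
  \<comment> \<open>On the diagonal the exchange formula yields 1/4 instead of 3/4; the extra
    summand supplies the missing 1/2.\<close>
  also have "\<dots> = (\<Sum>i\<in>?V. \<Sum>k\<in>?V. (2 * \<psi> (s \<circ> transp i k) - \<psi> s) / 4 + (if i = k then \<psi> s / 2 else 0))"
    by (intro sum.cong refl) (auto simp: sigma_dot_exchange sigma_dot_same)
  also have "\<dots> = (\<Sum>i\<in>?V. \<Sum>k\<in>?V. \<psi> s / 4 - (\<psi> s - \<psi> (s \<circ> transp i k)) / 2) + (\<Sum>i\<in>?V. \<psi> s / 2)"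
    unfolding sum.distrib
    by (intro arg_cong2[where f = "(+)"] sum.cong refl) (auto simp: finite_sites field_simps)
  also have "\<dots> = of_nat (N ^ D) * of_nat (N ^ D) * \<psi> s / 4
      - exchange_sum ?V (\<lambda>_ _. 1 / 2) \<psi> s + of_nat (N ^ D) * \<psi> s / 2"
    by (simp add: sum_subtractf card exchange_sum_def)
  finally show "Delta_S_sq N D \<psi> s = exchange_sum ?V (\<lambda>_ _. 1 / 2) \<psi> s"
    by (simp add: Delta_S_sq_def algebra_simps)
qed

text \<open>Each edge contributes \<open>2 * J\<close> times \<open>I - P\<close> to
  \<open>Delta_H\<close>. Dividing by \<open>4 * J\<close> removes the sign of \<open>J\<close>, so
  both signs are treated at once.\<close>

lemma Delta_H_exchange:
  assumes "J \<noteq> 0"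
  shows "(\<lambda>\<psi> s. of_real c * (Delta_H J N D \<psi> s / of_real (4 * J))) =
    exchange_sum (sites N D) (\<lambda>i k. if (i, k) \<in> edges N D then c / 2 else 0)"
proof (intro ext)
  fix \<psi> s
  have "heisenberg J N D \<psi> s = - of_real J * (\<Sum>(i, k)\<in>edges N D. \<psi> s - 2 * (\<psi> s - \<psi> (s \<circ> transp i k)))"
    unfolding heisenberg_def
    by (intro arg_cong[where f = "(*) _"] sum.cong refl)
      (auto simp: sigma_dot_exchange dest!: edges_in_sites)
  also have "(\<Sum>(i, k)\<in>edges N D. \<psi> s - 2 * (\<psi> s - \<psi> (s \<circ> transp i k))) =
      of_nat (card (edges N D)) * \<psi> s - 2 * (\<Sum>(i, k)\<in>edges N D. \<psi> s - \<psi> (s \<circ> transp i k))"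
    unfolding case_prod_unfold sum_subtractf[of _ "\<lambda>p. 2 * _ p"] sum_distrib_left
    by simp
  finally have "Delta_H J N D \<psi> s =
      2 * of_real J * (\<Sum>(i, k)\<in>edges N D. \<psi> s - \<psi> (s \<circ> transp i k))"
    by (simp add: Delta_H_def E_star_def algebra_simps)
  then have "of_real c * (Delta_H J N D \<psi> s / of_real (4 * J)) =
      of_real (c / 2) * (\<Sum>(i, k)\<in>edges N D. \<psi> s - \<psi> (s \<circ> transp i k))"
    using assms by simp
  also have "\<dots> = exchange_sum (sites N D) (\<lambda>i k. if (i, k) \<in> edges N D then c / 2 else 0) \<psi> s"
    unfolding sum_edges_eq exchange_sum_def sum_distrib_left
    by (intro sum.cong refl) auto
  finally show "of_real c * (Delta_H J N D \<psi> s / of_real (4 * J)) = \<dots>" .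
qed

text \<open>The difference is again an exchange sum, so positivity reduces to comparing weighted
  sums of squared distances.\<close>

lemma loewner_le_exchange_sum:
  assumes "\<And>\<psi>. (\<Sum>i\<in>V. \<Sum>k\<in>V. v i k * (exchange_dist V \<psi> i k)\<^sup>2) \<le>
      (\<Sum>i\<in>V. \<Sum>k\<in>V. w i k * (exchange_dist V \<psi> i k)\<^sup>2)"
  shows "loewner_le V (exchange_sum V v) (exchange_sum V w)"
proof -
  have "(\<lambda>\<psi> s. exchange_sum V w \<psi> s - exchange_sum V v \<psi> s) = exchange_sum V (\<lambda>i k. w i k - v i k)"
    by (simp add: exchange_sum_def fun_eq_iff sum_subtractf left_diff_distrib)
  then show ?thesis
    using assms by (simp add: loewner_le_def psd_op_def hermitian_exchange_sum
      Re_braket_exchange_sum left_diff_distrib sum_subtractf)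
qed

theorem mainTheorem4:
  "\<exists>(K::real) (c :: nat \<Rightarrow> nat \<Rightarrow> real). K > 0 \<and>
     (\<forall>N\<ge>2. \<forall>D\<ge>1.
        \<bar>c N D - (3 * real D + 1) * 2 ^ D / 12 * real N ^ (D + 2)\<bar>
          \<le> K * real D * 2 ^ D * real N ^ (D + 1)) \<and>
     (\<forall>N\<ge>2. \<forall>D\<ge>1. \<forall>J::real. J \<noteq> 0 \<longrightarrow>
        loewner_le (sites N D)
          (Delta_S_sq N D)
          (\<lambda>\<psi> s. of_real (c N D) * (Delta_H J N D \<psi> s / of_real (4 * J))))"
proof -
  \<comment> \<open>The coefficient is exactly the leading term, so the error is 0 and
    \<open>K = 1\<close> will do.\<close>
  define c where "c N D = (3 * real D + 1) * 2 ^ D / 12 * real N ^ (D + 2)" for N D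
  have "loewner_le (sites N D) (Delta_S_sq N D)
      (\<lambda>\<psi> s. of_real (c N D) * (Delta_H J N D \<psi> s / of_real (4 * J)))"
    if D: "D \<ge> 1" and J: "J \<noteq> 0" for N D and J :: real
    unfolding Delta_S_sq_exchange Delta_H_exchange[OF J]
  proof (rule loewner_le_exchange_sum)
    fix \<psi>
    let ?V = "sites N D"
    let ?d = "exchange_dist ?V \<psi>"
    let ?E = "\<Sum>(i, k)\<in>edges N D. (?d i k)\<^sup>2"
    interpret lattice_pseudometric N D ?d
      by unfold_locales
        (auto simp: exchange_dist_nonneg exchange_dist_self finite_sites
          intro: exchange_dist_commute exchange_dist_triangle)
    \<comment> \<open>The path constant fits below \<open>c N D\<close>, since D/3 is at most (3D +
      1)/6 and 2 is at most \<open>2 ^ D\<close>.\<close>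
    have "real D * real N ^ D * ((real N)\<^sup>2 - 1) / 3 \<le> real D / 3 * real N ^ (D + 2)"
      by (simp add: power_add power2_eq_square algebra_simps)
    also have "\<dots> \<le> (3 * real D + 1) * 2 / 12 * real N ^ (D + 2)"
      by (intro mult_right_mono) auto
    also have "\<dots> \<le> c N D"
      unfolding c_def using D power_increasing[of 1 D "2::real"]
      by (intro mult_right_mono divide_right_mono mult_left_mono) auto
    finally have "real D * real N ^ D * ((real N)\<^sup>2 - 1) / 3 * ?E \<le> c N D * ?E"
      by (intro mult_right_mono sum_nonneg) auto
    then have "(\<Sum>i\<in>?V. \<Sum>k\<in>?V. (?d i k)\<^sup>2) \<le> c N D * ?E"
      using sum_pairs_le_sum_edges[OF D] by linarith
    then have "(\<Sum>i\<in>?V. \<Sum>k\<in>?V. 1 / 2 * (?d i k)\<^sup>2) \<le> c N D / 2 * ?E"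
      by (simp add: sum_divide_distrib[symmetric])
    also have "\<dots> = (\<Sum>i\<in>?V. \<Sum>k\<in>?V. (if (i, k) \<in> edges N D then c N D / 2 else 0) * (?d i k)\<^sup>2)"
      unfolding sum_edges_eq sum_distrib_left by (intro sum.cong refl) auto
    finally show "(\<Sum>i\<in>?V. \<Sum>k\<in>?V. 1 / 2 * (?d i k)\<^sup>2) \<le>
        (\<Sum>i\<in>?V. \<Sum>k\<in>?V. (if (i, k) \<in> edges N D then c N D / 2 else 0) * (?d i k)\<^sup>2)" .
  qed
  then show ?thesis
    by (intro exI[of _ 1] exI[of _ c]) (auto simp: c_def)
qed

end
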